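(* Let $b\ge2$ be an integer. For a nonnegative integer $n$ with base-$b$ expansion $n=\sum_{i=0}^{N-1}n_ib^i$, define the base-$b$ generalized Fibonacci number $$F^{(b)}_{n} := \prod_{i=0}^{N-1}F_{n_i}.$$ Then these numbers satisfy $$F^{(b)}_{n} = \sum_{k \le_{b} n}\binom{n-k}{k}_b .$$
   Context: The Fibonacci numbers are normalized by $F_0=1$, $F_1=1$, $F_{m+1}=F_m+F_{m-1}$. Base-$b$ digits satisfy $0\le n_i\le b-1$. For nonnegative integers with base-$b$ digits $m_i$, $k_i$ (padded with zeros), the base-$b$ binomial coefficient is $\binom{m}{k}_b:=\prod_i\binom{m_i}{k_i}$, with $\binom{m_i}{k_i}=0$ if $k_i>m_i$. The relation $k\le_b n$ (digital dominance) means $k_i\le n_i$ for every $i$; the sum is over all nonnegative integers $k$ with $k\le_b n$. *)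

theory Defs
  imports "HOL-Library.Log_Nat" "HOL-Number_Theory.Fib"
begin

definition digit :: "nat \<Rightarrow> nat \<Rightarrow> nat \<Rightarrow> nat" where
  "digit b n i = n div b ^ i mod b"

text \<open>The normalization here is \<open>F\<^sub>0 = F\<^sub>1 = 1\<close>, whereas the library has \<^term>\<open>fib 0 = 0\<close>.\<close>

definition fibF :: "nat \<Rightarrow> nat" where
  "fibF m = fib (Suc m)"

lemma fibF_simps:
  "fibF 0 = 1"
  "fibF 1 = 1"
  "m \<ge> 1 \<Longrightarrow> fibF (m + 1) = fibF m + fibF (m - 1)"
  by (cases m; simp add: fibF_def)+

text \<open>
  For \<open>b \<ge> 2\<close>, \<^term>\<open>floorlog b n\<close> is the number of base-\<open>b\<close> digits of \<open>n\<close> (with no digits for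
  \<open>n = 0\<close>). Leading zeros do not change the product, see \<open>base_fib_padded\<close> below.
\<close>

definition base_fib :: "nat \<Rightarrow> nat \<Rightarrow> nat" where
  "base_fib b n = (\<Prod>i<floorlog b n. fibF (digit b n i))"

text \<open>The shorter of the two expansions is padded with zeros.\<close>

definition base_binomial :: "nat \<Rightarrow> nat \<Rightarrow> nat \<Rightarrow> nat" where
  "base_binomial b m k =
     (\<Prod>i<max (floorlog b m) (floorlog b k). digit b m i choose digit b k i)"

definition digit_dominated :: "nat \<Rightarrow> nat \<Rightarrow> nat \<Rightarrow> bool" where
  "digit_dominated b k n \<longleftrightarrow> (\<forall>i. digit b k i \<le> digit b n i)"

lemma digit_expansion:
  assumes "n < b ^ N"
  shows "(\<Sum>i<N. digit b n i * b ^ i) = n"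
proof -
  have "(\<Sum>i<N. digit b n i * b ^ i) = n mod b ^ N" for N
  proof (induction N)
    case (Suc N)
    then show ?case
      using mod_mult2_eq[of n "b ^ N" b] by (simp add: digit_def mult.commute)
  qed simp
  then show ?thesis using assms by simp
qed

lemma digit_eq_0:
  assumes "n < b ^ N" "b \<ge> 2" "i \<ge> N"
  shows "digit b n i = 0"
proof -
  have "b ^ N \<le> b ^ i" using assms by (intro power_increasing) auto
  then have "n div b ^ i = 0" using assms(1) by (intro div_less) linarith
  then show ?thesis by (simp add: digit_def)
qed

lemma base_fib_padded:
  assumes "b \<ge> 2" "n < b ^ N"
  shows "base_fib b n = (\<Prod>i<N. fibF (digit b n i))"
  unfolding base_fib_def
proof (rule prod.mono_neutral_left)
  show "{..<floorlog b n} \<subseteq> {..<N}"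
    using assms floorlog_leI[of n b N] by auto
  have "n < b ^ floorlog b n" using floorlog_leD[of b n "floorlog b n"] assms by simp
  then show "\<forall>i\<in>{..<N} - {..<floorlog b n}. fibF (digit b n i) = 1"
    using digit_eq_0 assms by (auto simp: fibF_simps)
qed simp

lemma base_binomial_padded:
  assumes "b \<ge> 2" "m < b ^ N" "k < b ^ N"
  shows "base_binomial b m k = (\<Prod>i<N. digit b m i choose digit b k i)"
  unfolding base_binomial_def
proof (rule prod.mono_neutral_left)
  let ?M = "max (floorlog b m) (floorlog b k)"
  show "{..<?M} \<subseteq> {..<N}"
    using assms floorlog_leI[of m b N] floorlog_leI[of k b N] by auto
  have "k < b ^ ?M" using floorlog_leD[of b k ?M] assms by simp
  then show "\<forall>i\<in>{..<N} - {..<?M}. (digit b m i choose digit b k i) = 1"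
    using digit_eq_0[of k b ?M] assms by (auto simp del: max_less_iff_conj)
qed simp

text \<open>
  Hence the truncated subtraction \<^term>\<open>n - k\<close> is the usual one for \<open>k \<le>\<^sub>b n\<close>, and a sum over all
  such \<open>k\<close> is finite.
\<close>

lemma digit_dominated_le:
  assumes "b \<ge> 2" "digit_dominated b k n"
  shows "k \<le> n"
proof -
  define N where "N = max (floorlog b k) (floorlog b n)"
  have kn: "k < b ^ N" "n < b ^ N"
    using floorlog_leD[of b k N] floorlog_leD[of b n N] assms by (auto simp: N_def)
  have "(\<Sum>i<N. digit b k i * b ^ i) \<le> (\<Sum>i<N. digit b n i * b ^ i)"
    using assms by (intro sum_mono mult_right_mono) (auto simp: digit_dominated_def)
  then show ?thesis using kn by (simp add: digit_expansion)
qed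

lemma finite_digit_dominated:
  assumes "b \<ge> 2"
  shows "finite {k. digit_dominated b k n}"
  by (rule finite_subset[of _ "{..n}"]) (use digit_dominated_le assms in auto)

end

theory Submission
  imports Defs
begin

text \<open>
  Splitting off the last digit, \<open>n = d + b m\<close>, makes both sides multiplicative: the numbers
  \<open>k \<le>\<^sub>b n\<close> are exactly the \<open>c + b j\<close> with \<open>c \<le> d\<close> and \<open>j \<le>\<^sub>b m\<close>, and then
  \<open>n - k = (d - c) + b (m - j)\<close> involves no borrowing. Each digit thus contributes the factor
  \<open>\<Sum>c\<le>d. (d - c) choose c = F\<^sub>d\<close>, the diagonal sum in Pascal's triangle.
\<close>

lemma digit_add_mult_0:
  assumes "d < b"
  shows "digit b (d + b * m) 0 = d"
  using assms by (simp add: digit_def)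

lemma digit_add_mult_Suc:
  assumes "d < b"
  shows "digit b (d + b * m) (Suc i) = digit b m i"
  using assms by (simp add: digit_def div_mult2_eq)

lemma add_mult_less_power_Suc:
  fixes b d m N :: nat
  assumes "d < b" "m < b ^ N"
  shows "d + b * m < b ^ Suc N"
proof -
  have "d + b * m < b * Suc m" using assms(1) by simp
  also have "\<dots> \<le> b * b ^ N" using assms(2) by (intro mult_left_mono) auto
  finally show ?thesis by simp
qed

lemma base_fib_add_mult:
  assumes "b \<ge> 2" "d < b"
  shows "base_fib b (d + b * m) = fibF d * base_fib b m"
proof -
  \<comment> \<open>A crude padding length: \<open>m\<close> has at most \<open>m\<close> digits, so
    \<open>d + b * m\<close> has at most \<open>Suc m\<close>. Peeling off index 0 leaves the padded
    product for \<open>m\<close>.\<close>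
  have m: "m < b ^ m" using assms by (intro power_gt_expt) auto
  show ?thesis
    using base_fib_padded[OF assms(1) add_mult_less_power_Suc[OF assms(2) m]]
      base_fib_padded[OF assms(1) m]
    by (simp add: prod.lessThan_Suc_shift digit_add_mult_0 digit_add_mult_Suc assms
        del: prod.lessThan_Suc power_Suc)
qed

lemma base_binomial_add_mult:
  assumes "b \<ge> 2" "d < b" "c < b"
  shows "base_binomial b (d + b * m) (c + b * j) = (d choose c) * base_binomial b m j"
proof -
  \<comment> \<open>One length has to pad both \<open>m\<close> and \<open>j\<close>.\<close>
  have "max m j < b ^ max m j" using assms by (intro power_gt_expt) auto
  then have mj: "m < b ^ max m j" "j < b ^ max m j" by auto
  show ?thesis
    using base_binomial_padded[OF assms(1) add_mult_less_power_Suc[OF assms(2) mj(1)]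
        add_mult_less_power_Suc[OF assms(3) mj(2)]]
      base_binomial_padded[OF assms(1) mj]
    by (simp add: prod.lessThan_Suc_shift digit_add_mult_0 digit_add_mult_Suc assms
        del: prod.lessThan_Suc power_Suc)
qed

lemma digit_dominated_add_mult_iff:
  assumes "c < b" "d < b"
  shows "digit_dominated b (c + b * j) (d + b * m) \<longleftrightarrow> c \<le> d \<and> digit_dominated b j m"
proof -
  \<comment> \<open>Position 0 compares \<open>c\<close> with \<open>d\<close>; the positions
    \<open>Suc i\<close> compare the digits of \<open>j\<close> and \<open>m\<close>.\<close>
  have "(\<forall>i. P i) \<longleftrightarrow> P 0 \<and> (\<forall>i. P (Suc i))" for P :: "nat \<Rightarrow> bool"
    by (metis not0_implies_Suc)
  from this[of "\<lambda>i. digit b (c + b * j) i \<le> digit b (d + b * m) i"] show ?thesis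
    by (simp add: digit_dominated_def digit_add_mult_0 digit_add_mult_Suc assms)
qed

lemma bij_betw_digit_dominated_add_mult:
  assumes "b \<ge> 2" "d < b"
  shows "bij_betw (\<lambda>(c, j). c + b * j) ({..d} \<times> {j. digit_dominated b j m})
    {k. digit_dominated b k (d + b * m)}"
\<comment> \<open>Division with remainder by \<open>b\<close> inverts the map because
  \<open>c \<le> d < b\<close>.\<close>
proof (rule bij_betw_byWitness[where f' = "\<lambda>k. (k mod b, k div b)"])
  have "k mod b \<le> d \<and> digit_dominated b (k div b) m"
    if "digit_dominated b k (d + b * m)" for k
    using that digit_dominated_add_mult_iff[of "k mod b" b d "k div b" m] assms by simp
  then show "(\<lambda>k. (k mod b, k div b)) ` {k. digit_dominated b k (d + b * m)}
      \<subseteq> {..d} \<times> {j. digit_dominated b j m}"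
    by auto
qed (use assms in \<open>auto simp: digit_dominated_add_mult_iff\<close>)

text \<open>The diagonal sum of Pascal's triangle is \<open>fib (Suc d)\<close>; the shifted
  normalization makes this \<open>fibF d\<close>. Terms with \<open>2 * c > d\<close>
  vanish.\<close>

lemma fibF_eq_sum_choose: "fibF d = (\<Sum>c\<le>d. (d - c) choose c)"
  by (simp add: fibF_def ne_diagonal_fib[symmetric] atLeast0AtMost)

text \<open>The counterpart of \<open>base_fib_add_mult\<close> for the sum: both sides of the
  theorem obey the same recursion on digits.\<close>

lemma sum_base_binomial_add_mult:
  assumes "b \<ge> 2" "d < b"
  shows "(\<Sum>k | digit_dominated b k (d + b * m). base_binomial b (d + b * m - k) k) =
    fibF d * (\<Sum>j | digit_dominated b j m. base_binomial b (m - j) j)"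
proof -
  have eq: "base_binomial b (d + b * m - (c + b * j)) (c + b * j) =
      (d - c choose c) * base_binomial b (m - j) j"
    if "c \<le> d" "digit_dominated b j m" for c j
  proof -
    \<comment> \<open>With \<open>c \<le> d\<close>, this keeps the truncated subtraction exact in
      the last digit and in the rest separately.\<close>
    have "b * j \<le> b * m" using digit_dominated_le[OF assms(1) that(2)] by simp
    then have "d + b * m - (c + b * j) = (d - c) + b * (m - j)"
      using that(1) by (simp add: diff_mult_distrib2)
    then show ?thesis
      using base_binomial_add_mult[of b "d - c" c "m - j" j] assms that(1) by simp
  qed
  have "(\<Sum>k | digit_dominated b k (d + b * m). base_binomial b (d + b * m - k) k) =
      (\<Sum>(c, j)\<in>{..d} \<times> {j. digit_dominated b j m}.
        (d - c choose c) * base_binomial b (m - j) j)"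
    by (subst sum.reindex_bij_betw[OF bij_betw_digit_dominated_add_mult[OF assms], symmetric])
      (intro sum.cong, auto simp: eq)
  then show ?thesis
    by (simp add: fibF_eq_sum_choose sum_product sum.cartesian_product)
qed

theorem theorem10:
  fixes b n :: nat
  assumes "b \<ge> 2"
  shows "base_fib b n = (\<Sum>k | digit_dominated b k n. base_binomial b (n - k) k)"
proof (induction n rule: less_induct)
  case (less n)
  show ?case
  proof (cases "n = 0")
    case True
    \<comment> \<open>Zero has no digits, so only \<open>k = 0\<close> is summed and all products
      are empty.\<close>
    have "{k. digit_dominated b k 0} = {0}"
      using digit_dominated_le[OF assms, of _ 0] by (auto simp: digit_dominated_def)
    then show ?thesis
      using True by (simp add: base_fib_def base_binomial_def floorlog_def)
  next
    case False
    \<comment> \<open>Dropping the last digit decreases \<open>n\<close>, as \<open>n > 0\<close>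
      and \<open>b \<ge> 2\<close>.\<close>
    then have IH: "base_fib b (n div b) =
        (\<Sum>j | digit_dominated b j (n div b). base_binomial b (n div b - j) j)"
      using assms by (intro less.IH) simp
    have d: "n mod b < b" using assms by simp
    show ?thesis
      using base_fib_add_mult[OF assms d, of "n div b"]
        sum_base_binomial_add_mult[OF assms d, of "n div b"] IH
      by simp
  qed
qed

end
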